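(* Let $x\in[0,1]$, let $b,s$ be positive integers and let $n$ be a nonnegative integer with $n\ge bs$. Then $$\frac{d}{dx}\mathfrak{S}_{n}(bs,x)=n\left(\mathfrak{S}_{n-1}(bs-1,x)-\mathfrak{S}_{n-1}(bs,x)\right).$$
   Context: For positive integers $b,s$ and $x\in[0,1]$, the polynomials $\mathfrak{S}_n(bs,x)$ ($n\ge 0$) are defined by the generating function $$\frac{2^{b}x^{bs}\left(\frac{t}{2}\right)^{bs}e^{t(1-x)}}{(bs)!}=\sum_{n=0}^{\infty}\mathfrak{S}_{n}(bs,x)\frac{t^{n}}{n!},\qquad t\in\mathbb{C}.$$ Here $\mathfrak{S}_n(bs,x)$ depends on the pair $(b,s)$, not only on the product $bs$. For the same fixed pair $(b,s)$, the polynomials $\mathfrak{S}_n(bs-1,x)$ are obtained by lowering the index $bs$ to $bs-1$ while keeping the constant factor $2^{b(1-s)}$: $$2^{b(1-s)}\frac{x^{bs-1}t^{bs-1}e^{t(1-x)}}{(bs-1)!}=\sum_{n=0}^{\infty}\mathfrak{S}_{n}(bs-1,x)\frac{t^{n}}{n!}.$$ The convention $0^0=1$ is used. *)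

theory Defs
  imports "HOL-Complex_Analysis.Complex_Analysis"
begin

text \<open>
  A sequence \<open>P\<close> of real polynomials has exponential generating function \<open>F\<close>: for every
  \<open>x \<in> [0,1]\<close> and every complex \<open>t\<close>, the series \<open>\<Sum>n. P n x * t ^ n / n!\<close> converges to \<open>F x t\<close>.
\<close>
definition has_egf :: "(nat \<Rightarrow> real poly) \<Rightarrow> (real \<Rightarrow> complex \<Rightarrow> complex) \<Rightarrow> bool" where
  "has_egf P F \<longleftrightarrow>
    (\<forall>x\<in>{0..1}. \<forall>t. (\<lambda>n. of_real (poly (P n) x) * t ^ n / fact n) sums F x t)"

definition genfun :: "nat \<Rightarrow> nat \<Rightarrow> real \<Rightarrow> complex \<Rightarrow> complex" where
  "genfun b s x t =
    2 ^ b * of_real x ^ (b * s) * (t / 2) ^ (b * s) * exp (t * (1 - of_real x)) / fact (b * s)"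

text \<open>
  The generating function for the lowered index \<open>b * s - 1\<close>.  Only the index is lowered: the factor
  \<open>2 powi (b * (1 - s))\<close> is the one of the pair \<open>(b, s)\<close>, and its exponent is an integer \<open>\<le> 0\<close>
  for \<open>s > 0\<close>.  The natural subtraction \<open>b * s - 1\<close> is exact for \<open>b, s > 0\<close>.
\<close>
definition genfun_lower :: "nat \<Rightarrow> nat \<Rightarrow> real \<Rightarrow> complex \<Rightarrow> complex" where
  "genfun_lower b s x t =
    2 powi (int b * (1 - int s)) *
      (of_real x ^ (b * s - 1) * t ^ (b * s - 1) * exp (t * (1 - of_real x)) / fact (b * s - 1))"

text \<open>
  \<open>frakS b s n\<close> is \<open>S\<^sub>n(bs, \<cdot>)\<close> and \<open>frakS_lower b s n\<close> is \<open>S\<^sub>n(bs - 1, \<cdot>)\<close> for the same pair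
  \<open>(b, s)\<close>.  Both descriptions have exactly one solution, see \<open>ex1_has_egf_genfun\<close> and
  \<open>ex1_has_egf_genfun_lower\<close> below.
\<close>
definition frakS :: "nat \<Rightarrow> nat \<Rightarrow> nat \<Rightarrow> real poly" where
  "frakS b s = (THE P. has_egf P (genfun b s))"

definition frakS_lower :: "nat \<Rightarrow> nat \<Rightarrow> nat \<Rightarrow> real poly" where
  "frakS_lower b s = (THE P. has_egf P (genfun_lower b s))"

lemma has_egf_unique:
  assumes P: "has_egf P F" and Q: "has_egf Q F"
  shows "P = Q"
proof
  fix n
  have eq: "poly (P n) x = poly (Q n) x" if x: "x \<in> {0..1}" for x
  proof -
    define a where "a k = complex_of_real (poly (P k) x - poly (Q k) x) / fact k" for k
    have *: "(\<lambda>k. a k * t ^ k) sums 0" for t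
    proof -
      have "(\<lambda>k. of_real (poly (P k) x) * t ^ k / fact k
              - of_real (poly (Q k) x) * t ^ k / fact k) sums (F x t - F x t)"
        using P Q x unfolding has_egf_def by (intro sums_diff) auto
      then show ?thesis
        by (simp add: a_def diff_divide_distrib left_diff_distrib)
    qed
    have "(\<lambda>_. 0) has_fps_expansion Abs_fps a"
      by (rule has_fps_expansionI) (use * in simp)
    then have "Abs_fps a = 0"
      using fps_expansion_unique_complex[of "\<lambda>_. 0"] has_fps_expansion_0 by blast
    then have "a n = 0"
      by (metis fps_nth_Abs_fps fps_zero_nth)
    then show ?thesis by (simp add: a_def)
  qed
  show "P n = Q n"
  proof (rule ccontr)
    assume "P n \<noteq> Q n"
    then have "finite {x. poly (P n - Q n) x = 0}" by (intro poly_roots_finite) simp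
    moreover have "{0..1} \<subseteq> {x. poly (P n - Q n) x = 0}" using eq by auto
    ultimately have "finite {0..1::real}" by (rule rev_finite_subset)
    then show False using infinite_Icc[of 0 "1::real"] by simp
  qed
qed

lemma ex1_has_egf_power_exp:
  assumes F: "\<And>x t. F x t = of_real c * of_real x ^ m * t ^ m * exp (t * (1 - of_real x)) / fact m"
  shows "\<exists>!P. has_egf P F"
proof (rule ex_ex1I)
  define P where "P n = (if n < m then 0
    else smult (c * fact n / (fact m * fact (n - m))) ([:0, 1:] ^ m * [:1, -1:] ^ (n - m)))" for n
  have "(\<lambda>n. of_real (poly (P n) x) * t ^ n / fact n) sums F x t" for x t
  proof (subst sums_zero_iff_shift[of m, symmetric])
    fix i assume "i < m"
    then show "of_real (poly (P i) x) * t ^ i / fact i = 0"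
      by (simp add: P_def)
  next
    have "(\<lambda>k. of_real c * of_real x ^ m * t ^ m / fact m * ((t * (1 - of_real x)) ^ k /\<^sub>R fact k))
        sums (of_real c * of_real x ^ m * t ^ m / fact m * exp (t * (1 - of_real x)))"
      by (intro sums_mult exp_converges)
    moreover have "of_real (poly (P (k + m)) x) * t ^ (k + m) / fact (k + m)
        = of_real c * of_real x ^ m * t ^ m / fact m * ((t * (1 - of_real x)) ^ k /\<^sub>R fact k)" for k
      by (simp add: P_def scaleR_conv_of_real power_mult_distrib power_add divide_simps mult_ac)
    ultimately show "(\<lambda>k. of_real (poly (P (k + m)) x) * t ^ (k + m) / fact (k + m)) sums F x t"
      by (simp add: F)
  qed
  then show "\<exists>P. has_egf P F"
    unfolding has_egf_def by blast
qed (rule has_egf_unique)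

lemma ex1_has_egf_genfun: "\<exists>!P. has_egf P (genfun b s)"
  by (rule ex1_has_egf_power_exp[where c = "2 ^ b / 2 ^ (b * s)" and m = "b * s"])
    (simp add: genfun_def power_divide)

lemma ex1_has_egf_genfun_lower: "\<exists>!P. has_egf P (genfun_lower b s)"
  by (rule ex1_has_egf_power_exp[where c = "2 powi (int b * (1 - int s))" and m = "b * s - 1"])
    (simp add: genfun_lower_def)

end

theory Submission
  imports Defs
begin

text \<open>
  Expanding the generating function \<open>c * x ^ m * t ^ m * exp (t * (1 - x)) / m!\<close> in powers of
  \<open>t\<close> shows that its polynomials are \<open>c\<close> times the Bernstein basis polynomials
  \<open>B\<^sub>n\<^sub>,\<^sub>m(x) = (n choose m) * x ^ m * (1 - x) ^ (n - m)\<close>.  By uniqueness of the exponential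
  generating function, \<open>frakS b s n\<close> and \<open>frakS_lower b s n\<close> are multiples of \<open>B\<^sub>n\<^sub>,\<^sub>m\<close> and
  \<open>B\<^sub>n\<^sub>,\<^sub>m\<^sub>-\<^sub>1\<close> with \<open>m = b * s\<close>, and the factor is the same in both cases,
  because lowering the index keeps the constant \<open>c = 2 ^ b / 2 ^ (b * s)\<close>.  The claim is therefore \<open>c\<close> times the classical derivative
  formula \<open>B'\<^sub>n\<^sub>,\<^sub>m = n * (B\<^sub>n\<^sub>-\<^sub>1\<^sub>,\<^sub>m\<^sub>-\<^sub>1 - B\<^sub>n\<^sub>-\<^sub>1\<^sub>,\<^sub>m)\<close>, which is the product rule combined with the
  two absorption identities of binomial coefficients.
\<close>

definition bernstein_poly :: "nat \<Rightarrow> nat \<Rightarrow> real poly" where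
  "bernstein_poly n m = smult (of_nat (n choose m)) ([:0, 1:] ^ m * [:1, -1:] ^ (n - m))"

lemma poly_bernstein_poly [simp]: "poly (bernstein_poly n m) x = Bernstein n m x"
  by (simp add: bernstein_poly_def Bernstein_def mult.assoc)

text \<open>
  The factor \<open>t ^ m\<close> only shifts the exponential series, so that the coefficient of \<open>t ^ (k + m)\<close>
  is \<open>c * x ^ m * (1 - x) ^ k / (m! * k!)\<close>; the factorials combine with \<open>(k + m)!\<close> to a binomial
  coefficient, which also vanishes on the \<open>m\<close> leading terms.
\<close>
lemma has_egf_bernstein_poly:
  assumes F: "\<And>x t. F x t = of_real c * of_real x ^ m * t ^ m * exp (t * (1 - of_real x)) / fact m"
  shows "has_egf (\<lambda>n. smult c (bernstein_poly n m)) F"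
proof -
  have "(\<lambda>n. of_real (poly (smult c (bernstein_poly n m)) x) * t ^ n / fact n) sums F x t" for x t
  proof (subst sums_zero_iff_shift[of m, symmetric])
    fix i assume "i < m"
    then show "of_real (poly (smult c (bernstein_poly i m)) x) * t ^ i / fact i = 0"
      by (simp add: Bernstein_def)
  next
    let ?a = "of_real c * of_real x ^ m * t ^ m / fact m"
    have "(\<lambda>k. ?a * ((t * (1 - of_real x)) ^ k /\<^sub>R fact k)) sums (?a * exp (t * (1 - of_real x)))"
      by (intro sums_mult exp_converges)
    moreover have "of_real (poly (smult c (bernstein_poly (k + m) m)) x) * t ^ (k + m) / fact (k + m)
        = ?a * ((t * (1 - of_real x)) ^ k /\<^sub>R fact k)" for k
      by (simp add: Bernstein_def binomial_fact scaleR_conv_of_real power_mult_distrib power_add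
          divide_simps mult_ac)
    ultimately show "(\<lambda>k. of_real (poly (smult c (bernstein_poly (k + m) m)) x) * t ^ (k + m)
        / fact (k + m)) sums F x t"
      by (simp add: F)
  qed
  then show ?thesis
    unfolding has_egf_def by blast
qed

lemma frakS_eq_bernstein_poly:
  "frakS b s n = smult (2 ^ b / 2 ^ (b * s)) (bernstein_poly n (b * s))"
proof -
  have "has_egf (\<lambda>n. smult (2 ^ b / 2 ^ (b * s)) (bernstein_poly n (b * s))) (genfun b s)"
    by (rule has_egf_bernstein_poly) (simp add: genfun_def power_divide)
  then have "frakS b s = (\<lambda>n. smult (2 ^ b / 2 ^ (b * s)) (bernstein_poly n (b * s)))"
    unfolding frakS_def by (intro the1_equality ex1_has_egf_genfun)
  then show ?thesis
    by simp
qed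

lemma frakS_lower_eq_bernstein_poly:
  "frakS_lower b s n = smult (2 ^ b / 2 ^ (b * s)) (bernstein_poly n (b * s - 1))"
proof -
  have "(2 :: complex) powi (int b * (1 - int s)) = 2 powi (int b - int (b * s))"
    by (simp add: algebra_simps)
  also have "\<dots> = 2 ^ b / 2 ^ (b * s)"
    by (subst power_int_diff) (simp_all only: power_int_of_nat, simp)
  finally have "has_egf (\<lambda>n. smult (2 ^ b / 2 ^ (b * s)) (bernstein_poly n (b * s - 1)))
      (genfun_lower b s)"
    by (intro has_egf_bernstein_poly) (simp add: genfun_lower_def)
  then have "frakS_lower b s =
      (\<lambda>n. smult (2 ^ b / 2 ^ (b * s)) (bernstein_poly n (b * s - 1)))"
    unfolding frakS_lower_def by (intro the1_equality ex1_has_egf_genfun_lower)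
  then show ?thesis
    by simp
qed

text \<open>
  The product rule gives one term for each factor.  The identity
  \<open>(k + 1) * (n + 1 choose k + 1) = (n + 1) * (n choose k)\<close> turns the first into the lowered
  Bernstein polynomial, and \<open>(n - k) * (n + 1 choose k + 1) = (n + 1) * (n choose k + 1)\<close> turns the
  second into the one with the same lower index.
\<close>
lemma has_real_derivative_Bernstein:
  "(Bernstein (Suc n) (Suc k) has_real_derivative
      real (Suc n) * (Bernstein n k x - Bernstein n (Suc k) x)) (at x)"
proof -
  have lower: "real (Suc n choose Suc k) * real (Suc k) = real (Suc n) * real (n choose k)"
    using Suc_times_binomial_eq[of n k] by (metis of_nat_mult)
  have same: "real (Suc n choose Suc k) * real (n - k) = real (Suc n) * real (n choose Suc k)"
    using binomial_absorb_comp[of "Suc n" "Suc k"]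
    by (metis diff_Suc_Suc diff_Suc_1 mult.commute of_nat_mult)
  have "(Bernstein (Suc n) (Suc k) has_real_derivative
      real (Suc n choose Suc k) * real (Suc k) * x ^ k * (1 - x) ^ (n - k)
      - real (Suc n choose Suc k) * real (n - k) * x ^ Suc k * (1 - x) ^ (n - k - 1)) (at x)"
    unfolding Bernstein_def
    by (rule derivative_eq_intros refl)+ (simp add: algebra_simps)
  then show ?thesis
    unfolding lower same by (simp add: Bernstein_def algebra_simps)
qed

theorem theorem2:
  fixes x :: real and b s n :: nat
  assumes "x \<in> {0..1}" and "b > 0" and "s > 0" and "n \<ge> b * s"
  shows "((\<lambda>y. poly (frakS b s n) y) has_real_derivative
    real n * (poly (frakS_lower b s (n - 1)) x - poly (frakS b s (n - 1)) x)) (at x)"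
proof -
  have "b * s > 0"
    using assms by simp
  then obtain k where k: "b * s = Suc k"
    using gr0_implies_Suc by blast
  moreover obtain l where l: "n = Suc l"
    using assms k by (cases n) auto
  ultimately show ?thesis
    using DERIV_cmult[OF has_real_derivative_Bernstein[of l k x], of "2 ^ b / 2 ^ (b * s)"]
    by (simp add: frakS_eq_bernstein_poly frakS_lower_eq_bernstein_poly right_diff_distrib mult_ac)
qed

end
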